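(* Let $n,k\in\mathbb{N}$, $\delta\in(0,1)$, and consider a general expiration stream of $n$ items. The sample-thinned sketch (described in the context) can, at any point $t_0$ of the stream and for any future time $t\ge t_0$ such that $t$ is not in the tail zone, retrieve $k$ items forming a uniformly random sample without replacement from the active set $A(t)$; for $t$ in the tail zone it retrieves all items of $A(t)$ (at most $k$). With probability at least $1-\delta$, the sketch never stores more than $k(9\ln n+8+\ln(1/\delta))$ items during the whole stream.
   Context: General expiration stream: items $x_1,\dots,x_n$ arrive in order, each with insertion time $S(x_i)$ (non-decreasing) and arbitrary expiration time $E(x_i)>S(x_i)$; $x$ is active at time $t$ iff $S(x)\le t<E(x)$. For a current time $t_0$ and a future time $t\ge t_0$, $A(t)$ denotes the set of items already inserted by $t_0$ that are active at $t$ (assuming no further insertions), and $t$ is in the tail zone if $|A(t)|\le k$. Sample-thinned sketch: on insertion of $x_i$, assign it an independent priority $u_i\sim\mathrm{Unif}(0,1]$ and store it; expired items are removed; thinning step: any stored item $x_j$ is removed if at least $k$ other stored items have expiration time at least $E(x_j)$ and priority smaller than $u_j$. On a query for future time $t$, report the $k$ stored items with smallest priorities among those with expiration time after $t$. *)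

theory Defs
  imports "HOL-Probability.Probability"
begin

text \<open>
  The items of the stream are identified with the indices \<open>0, \<dots>, n - 1\<close>, in order of arrival;
  \<open>S i\<close>, \<open>E i\<close> and \<open>u i\<close> are insertion time, expiration time and priority of item \<open>i\<close>.
\<close>

definition expiration_stream :: "nat \<Rightarrow> (nat \<Rightarrow> real) \<Rightarrow> (nat \<Rightarrow> real) \<Rightarrow> bool" where
  "expiration_stream n S E \<longleftrightarrow>
     (\<forall>i j. i \<le> j \<and> j < n \<longrightarrow> S i \<le> S j) \<and> (\<forall>i<n. S i < E i)"

text \<open>
  A point of the stream is a current time \<open>t\<^sub>0\<close> together with the number \<open>m\<close> of items inserted so far.
  When \<open>t\<^sub>0\<close> is itself an insertion time (possibly shared by several items), \<open>t\<^sub>0\<close> alone does not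
  determine \<open>m\<close>; every choice compatible with the insertion times is admitted, including the one
  where all items with \<open>S i \<le> t\<^sub>0\<close> have been inserted.
\<close>

definition stream_point :: "nat \<Rightarrow> (nat \<Rightarrow> real) \<Rightarrow> nat \<Rightarrow> real \<Rightarrow> bool" where
  "stream_point n S m t0 \<longleftrightarrow>
     m \<le> n \<and> (\<forall>i<m. S i \<le> t0) \<and> (\<forall>i. m \<le> i \<and> i < n \<longrightarrow> t0 \<le> S i)"

definition active_set :: "(nat \<Rightarrow> real) \<Rightarrow> (nat \<Rightarrow> real) \<Rightarrow> nat \<Rightarrow> real \<Rightarrow> nat set" where
  "active_set S E m t = {i. i < m \<and> S i \<le> t \<and> t < E i}"

definition tail_zone :: "nat \<Rightarrow> (nat \<Rightarrow> real) \<Rightarrow> (nat \<Rightarrow> real) \<Rightarrow> nat \<Rightarrow> real \<Rightarrow> bool" where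
  "tail_zone k S E m t \<longleftrightarrow> card (active_set S E m t) \<le> k"

definition expire :: "(nat \<Rightarrow> real) \<Rightarrow> real \<Rightarrow> nat set \<Rightarrow> nat set" where
  "expire E t P = {i \<in> P. t < E i}"

text \<open>
  All removals of a thinning step are carried out simultaneously. Removing the items one at a time
  leads to the same set: an item with at least \<open>k\<close> dominating items in \<open>P\<close> has at least \<open>k\<close>
  dominating items that are not themselves removed.
\<close>

definition thin :: "nat \<Rightarrow> (nat \<Rightarrow> real) \<Rightarrow> (nat \<Rightarrow> real) \<Rightarrow> nat set \<Rightarrow> nat set" where
  "thin k E u P = {j \<in> P. \<not> k \<le> card {i \<in> P - {j}. E j \<le> E i \<and> u i < u j}}"

text \<open>Contents of the sketch directly after the first \<open>m\<close> items have been processed.\<close>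

fun sketch :: "nat \<Rightarrow> (nat \<Rightarrow> real) \<Rightarrow> (nat \<Rightarrow> real) \<Rightarrow> (nat \<Rightarrow> real) \<Rightarrow> nat \<Rightarrow> nat set" where
  "sketch k S E u 0 = {}"
| "sketch k S E u (Suc m) = thin k E u (expire E (S m) (insert m (sketch k S E u m)))"

definition stored ::
  "nat \<Rightarrow> (nat \<Rightarrow> real) \<Rightarrow> (nat \<Rightarrow> real) \<Rightarrow> (nat \<Rightarrow> real) \<Rightarrow> nat \<Rightarrow> real \<Rightarrow> nat set" where
  "stored k S E u m t0 = expire E t0 (sketch k S E u m)"

text \<open>
  Everything the sketch holds at some moment of the stream, including the intermediate contents
  during the processing of an insertion (before expired items are removed and before thinning).
\<close>

definition memory_states ::
  "nat \<Rightarrow> nat \<Rightarrow> (nat \<Rightarrow> real) \<Rightarrow> (nat \<Rightarrow> real) \<Rightarrow> (nat \<Rightarrow> real) \<Rightarrow> nat set set" where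
  "memory_states k n S E u =
     {sketch k S E u m | m. m \<le> n}
     \<union> {stored k S E u m t0 | m t0. stream_point n S m t0}
     \<union> {insert m (sketch k S E u m) | m. m < n}
     \<union> {expire E (S m) (insert m (sketch k S E u m)) | m. m < n}"

text \<open>
  The \<open>k\<close> elements of \<open>P\<close> of smallest priority among those expiring after \<open>t\<close>, or all of them if
  there are fewer than \<open>k\<close>. Ties between priorities (a null event) are broken by the index.
\<close>

definition query :: "nat \<Rightarrow> (nat \<Rightarrow> real) \<Rightarrow> (nat \<Rightarrow> real) \<Rightarrow> nat set \<Rightarrow> real \<Rightarrow> nat set" where
  "query k E u P t = set (take k (sort_key u (sorted_list_of_set {i \<in> P. t < E i})))"

end

theory Submission
  imports Defs
begin

text \<open>
  An item is stored exactly if it has not expired and fewer than \<open>k\<close> of \<^emph>\<open>all\<close> inserted items dominate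
  it (expire no earlier and have smaller priority): the \<open>k\<close> smallest dominators of an item are
  themselves never thinned out. Hence the \<open>k\<close> smallest priorities of the active set always survive,
  and by exchangeability of the priorities they belong to a uniformly random \<open>k\<close>-subset.

  For the memory bound, remove the items in order of decreasing priority. The item of largest priority
  dominates nobody, and it is equally likely to be any of the \<open>r\<close> remaining items, so it is stored with
  probability at most \<open>k / r\<close>. Hence the number \<open>X\<close> of undominated ones among \<open>m\<close> items satisfies
  \<open>\<bbbE> (exp X) \<le> (\<Prod>r = 1..m. 1 + (e - 1) k / r) \<le> exp (2 k H\<^sub>m)\<close>, and Markov's inequality with a union
  bound over the \<open>n\<close> insertions concludes.
\<close>

subsection \<open>Contents of the sketch\<close>

text \<open>Ranges over all \<open>m\<close> inserted items, stored or not, so it does not depend on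
  the history of thinning. The strict comparison keeps an item from dominating itself.\<close>

definition dominators :: "(nat \<Rightarrow> real) \<Rightarrow> (nat \<Rightarrow> real) \<Rightarrow> nat \<Rightarrow> nat \<Rightarrow> nat set" where
  "dominators E u m i = {j. j < m \<and> E i \<le> E j \<and> u j < u i}"

lemma finite_dominators [simp]: "finite (dominators E u m i)"
  by (simp add: dominators_def)

text \<open>Greedy: keep adding a minimiser of \<open>u\<close> on the rest. Priorities may tie,
  hence the weak comparison.\<close>

lemma obtain_lowest_subset:
  fixes u :: "'a \<Rightarrow> real"
  assumes "finite D" "k \<le> card D"
  obtains T where "T \<subseteq> D" "card T = k" "\<And>j x. j \<in> T \<Longrightarrow> x \<in> D - T \<Longrightarrow> u j \<le> u x"
proof -
  have "\<exists>T\<subseteq>D. card T = k \<and> (\<forall>j\<in>T. \<forall>x\<in>D - T. u j \<le> u x)"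
    using assms(2)
  proof (induction k)
    case 0
    then show ?case by (intro exI[of _ "{}"]) auto
  next
    case (Suc k)
    then obtain T where T: "T \<subseteq> D" "card T = k" "\<forall>j\<in>T. \<forall>x\<in>D - T. u j \<le> u x"
      by auto
    have "finite T"
      using T(1) assms(1) finite_subset by blast
    have "D - T \<noteq> {}"
      using T Suc.prems by auto
    then obtain y where y: "y \<in> D - T" "\<forall>x\<in>D - T. u y \<le> u x"
      using assms(1) by (metis arg_min_if_finite(1) arg_min_least finite_Diff)
    show ?case
      using T y \<open>finite T\<close> by (intro exI[of _ "insert y T"]) auto
  qed
  then show thesis using that by blast
qed

text \<open>Expiry never removes a dominator of a live item, since dominators expire no earlier, and
  dominator sets only grow with \<open>m\<close>, so an item once thinned out fails the condition
  forever. It remains to compare dominators in the current store with dominators among all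
  items.\<close>

lemma sketch_eq:
  assumes "expiration_stream n S E" "m \<le> n"
  shows "sketch k S E u m = {i. i < m \<and> (\<forall>j<m. S j < E i) \<and> card (dominators E u m i) < k}"
  using assms(2)
proof (induction m)
  case 0
  then show ?case by simp
next
  case (Suc m)
  have mono: "S j \<le> S m" if "j < Suc m" for j
    using assms(1) that Suc.prems unfolding expiration_stream_def by (simp add: less_Suc_eq_le)
  have "S m < E m"
    using assms(1) Suc.prems by (simp add: expiration_stream_def)
  define Q where "Q = expire E (S m) (insert m (sketch k S E u m))"
  have Q: "Q = {i. i < Suc m \<and> S m < E i \<and> (i < m \<longrightarrow> card (dominators E u m i) < k)}"
    using Suc mono \<open>S m < E m\<close> unfolding Q_def expire_def
    by (auto simp: less_Suc_eq intro: le_less_trans)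
  \<comment> \<open>Insertion times are non-decreasing, so passing the latest expiry check implies
    passing all earlier ones.\<close>
  have lastS: "(\<forall>j<Suc m. S j < E i) \<longleftrightarrow> S m < E i" for i
    using mono by (meson le_less_trans lessI)
  have dom_mono: "dominators E u m i \<subseteq> dominators E u (Suc m) i" for i
    by (auto simp: dominators_def)
  have iff: "card {j \<in> Q - {i}. E i \<le> E j \<and> u j < u i} < k \<longleftrightarrow> card (dominators E u (Suc m) i) < k"
    if "i \<in> Q" for i
  proof
    assume "card (dominators E u (Suc m) i) < k"
    moreover have "{j \<in> Q - {i}. E i \<le> E j \<and> u j < u i} \<subseteq> dominators E u (Suc m) i"
      by (auto simp: Q dominators_def)
    ultimately show "card {j \<in> Q - {i}. E i \<le> E j \<and> u j < u i} < k"
      by (meson card_mono finite_dominators le_less_trans)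
  next
    assume less: "card {j \<in> Q - {i}. E i \<le> E j \<and> u j < u i} < k"
    show "card (dominators E u (Suc m) i) < k"
    proof (rule ccontr)
      let ?D = "dominators E u (Suc m) i"
      assume "\<not> card ?D < k"
      \<comment> \<open>\<open>T\<close> collects \<open>k\<close> dominators of \<open>i\<close> of
        lowest priority. All of \<open>T\<close> turns out to lie in \<open>Q\<close>, which
        contradicts \<open>less\<close>.\<close>
      then obtain T where T: "T \<subseteq> ?D" "card T = k" "\<And>j x. j \<in> T \<Longrightarrow> x \<in> ?D - T \<Longrightarrow> u j \<le> u x"
        using obtain_lowest_subset[of ?D k u] by auto
      have fin: "finite T" using T(1) finite_dominators by (rule finite_subset)
      have "j \<in> Q" if "j \<in> T" for j
      proof -
        have j: "j < Suc m" "E i \<le> E j" "u j < u i"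
          using that T(1) by (auto simp: dominators_def)
        \<comment> \<open>Domination is transitive, so \<open>x\<close> dominates \<open>i\<close>;
          since \<open>u x < u j\<close>, the choice of \<open>T\<close> forces \<open>x\<close>
          into \<open>T\<close>. Hence \<open>j\<close> has at most \<open>k - 1\<close>
          dominators.\<close>
        have "dominators E u m j \<subseteq> T - {j}"
        proof
          fix x assume "x \<in> dominators E u m j"
          then have x: "x < m" "E j \<le> E x" "u x < u j" by (auto simp: dominators_def)
          then have "x \<in> ?D" using j by (auto simp: dominators_def)
          then show "x \<in> T - {j}" using T(3)[OF that, of x] x by force
        qed
        then have "card (dominators E u m j) \<le> card (T - {j})"
          using fin by (intro card_mono) auto
        also have "\<dots> < k" using fin that T(2) by (metis card_Diff1_less)
        finally show ?thesis using j \<open>i \<in> Q\<close> by (auto simp: Q)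
      qed
      then have "T \<subseteq> {j \<in> Q - {i}. E i \<le> E j \<and> u j < u i}"
        using T(1) by (auto simp: dominators_def)
      moreover have "finite Q" by (rule finite_subset[of _ "{..<Suc m}"]) (auto simp: Q)
      ultimately have "k \<le> card {j \<in> Q - {i}. E i \<le> E j \<and> u j < u i}"
        using T(2) card_mono[of "{j \<in> Q - {i}. E i \<le> E j \<and> u j < u i}" T] by simp
      then show False using less by simp
    qed
  qed
  have "sketch k S E u (Suc m) = {i \<in> Q. card (dominators E u (Suc m) i) < k}"
    using iff by (auto simp: thin_def Q_def not_le)
  also have "\<dots> = {i. i < Suc m \<and> (\<forall>j<Suc m. S j < E i) \<and> card (dominators E u (Suc m) i) < k}"
    unfolding lastS Q using dom_mono
    by (auto intro: le_less_trans[OF card_mono[OF finite_dominators]])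
  finally show ?case .
qed

subsection \<open>Priority orders and queries\<close>

text \<open>Same tie rule as in \<open>query\<close>: stable sorting of the index-ordered list
  leaves equal priorities in index order.\<close>

definition priority_order :: "('a::linorder \<Rightarrow> real) \<Rightarrow> 'a set \<Rightarrow> 'a list" where
  "priority_order u A = sort_key u (sorted_list_of_set A)"

lemma priority_order_props:
  assumes "finite A"
  shows "set (priority_order u A) = A" "distinct (priority_order u A)"
    "length (priority_order u A) = card A" "sorted (map u (priority_order u A))"
  using assms by (simp_all add: priority_order_def)

lemma priority_order_in_permutations:
  "finite A \<Longrightarrow> priority_order u A \<in> permutations_of_set A"
  by (simp add: permutations_of_set_def priority_order_props)

text \<open>Strict inequalities along \<open>w\<close> leave no freedom in sorting. This turns the
  event that the order is \<open>w\<close> into one about the joint law of the priorities.\<close>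

lemma priority_order_unique:
  assumes "finite A" "w \<in> permutations_of_set A" "sorted_wrt (<) (map u w)"
  shows "priority_order u A = w"
proof (rule map_sorted_distinct_set_unique[where f = u])
  note * = strict_sorted_iff[of "map u w", THEN iffD1, OF assms(3)]
  have "set w = A" "distinct w" using assms(2) by (auto simp: permutations_of_set_def)
  then show "inj_on u (set (priority_order u A) \<union> set w)"
    using * assms(1) by (simp add: priority_order_props distinct_map)
  then show "distinct (map u (priority_order u A))"
    using assms(1) by (simp add: distinct_map priority_order_props inj_on_Un)
  show "sorted (map u w)" "distinct (map u w)" using * by auto
  show "set (priority_order u A) = set w" "sorted (map u (priority_order u A))"
    using \<open>set w = A\<close> assms(1) by (simp_all add: priority_order_props)
qed

text \<open>Insertion sort consults priorities only through comparisons. Measurability of the random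
  order rests on this.\<close>

lemma priority_order_cong:
  assumes "finite A" "\<And>i j. i \<in> A \<Longrightarrow> j \<in> A \<Longrightarrow> u i < u j \<longleftrightarrow> v i < v j"
  shows "priority_order u A = priority_order v A"
proof -
  have ins: "insort_key u x ys = insort_key v x ys" if "insert x (set ys) \<subseteq> A" for x ys
    using that by (induction ys) (auto simp: assms(2) simp flip: not_less)
  have "sort_key u xs = sort_key v xs" if "set xs \<subseteq> A" for xs
    using that by (induction xs) (auto intro!: ins)
  then show ?thesis using assms(1) by (simp add: priority_order_def)
qed

lemma take_filter_eq:
  assumes "\<forall>x\<in>set (take k xs). P x"
  shows "take k (filter P xs) = take k xs"
proof -
  have "filter P xs = take k xs @ filter P (drop k xs)"
    using assms by (metis append_take_drop_id filter_append filter_True)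
  then show ?thesis by (cases "k \<le> length xs") auto
qed

text \<open>Everything of smaller priority than the entry at position \<open>p\<close> precedes it
  in the sorted list, and only \<open>p < k\<close> places do.\<close>

lemma card_lower_priority_less:
  assumes "finite A" "x \<in> set (take k (priority_order u A))"
  shows "card {j \<in> A. u j < u x} < k"
proof -
  let ?w = "priority_order u A"
  obtain p where p: "p < k" "p < length ?w" "?w ! p = x"
    using assms(2) by (auto simp: in_set_conv_nth)
  have "{j \<in> A. u j < u x} \<subseteq> set (take p ?w)"
  proof
    fix j assume j: "j \<in> {j \<in> A. u j < u x}"
    then obtain q where q: "q < length ?w" "?w ! q = j"
      using priority_order_props(1)[OF assms(1), of u] by (metis (no_types, lifting) in_set_conv_nth mem_Collect_eq)
    have "\<not> p \<le> q"
      using sorted_nth_mono[OF priority_order_props(4)[OF assms(1), of u], of p q] p q j by auto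
    then show "j \<in> set (take p ?w)" using q by (auto simp: in_set_conv_nth)
  qed
  then have "card {j \<in> A. u j < u x} \<le> card (set (take p ?w))"
    by (intro card_mono) auto
  also have "\<dots> \<le> p" by (rule order.trans[OF card_length]) simp
  finally show ?thesis using p by simp
qed

lemma active_set_eq:
  assumes "stream_point n S m t0" "t0 \<le> t"
  shows "active_set S E m t = {i. i < m \<and> t < E i}"
  using assms unfolding active_set_def stream_point_def by force

text \<open>Holds for every outcome, ties included, since dominators have strictly smaller priority.\<close>

lemma query_stored_eq:
  assumes "expiration_stream n S E" "stream_point n S m t0" "t0 \<le> t"
  shows "query k E u (stored k S E u m t0) t
           = set (take k (priority_order u (active_set S E m t)))"
proof -
  define A where "A = active_set S E m t"
  have A: "A = {i. i < m \<and> t < E i}" unfolding A_def using active_set_eq assms by blast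
  have fin: "finite A" unfolding A by simp
  define P where "P i \<longleftrightarrow> card (dominators E u m i) < k" for i
  have m: "m \<le> n" and le: "\<And>j. j < m \<Longrightarrow> S j \<le> t0"
    using assms(2) by (auto simp: stream_point_def)
  have "{i \<in> stored k S E u m t0. t < E i} = {i \<in> A. P i}"
    using assms(3) le unfolding stored_def expire_def sketch_eq[OF assms(1) m] A P_def
    by force
  moreover have "sorted_list_of_set {i \<in> A. P i} = filter P (sorted_list_of_set A)"
    using fin by (intro sorted_distinct_set_unique) (auto simp: sorted_wrt_filter)
  ultimately have "query k E u (stored k S E u m t0) t = set (take k (filter P (priority_order u A)))"
    by (simp add: query_def priority_order_def filter_sort)
  also have "take k (filter P (priority_order u A)) = take k (priority_order u A)"
  proof (intro take_filter_eq ballI)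
    fix x assume x: "x \<in> set (take k (priority_order u A))"
    then have "x \<in> A" using fin by (metis in_set_takeD priority_order_props(1))
    \<comment> \<open>A dominator of \<open>x\<close> expires no earlier than \<open>x\<close>,
      hence after \<open>t\<close>, and so belongs to \<open>A\<close>.\<close>
    then have "dominators E u m x \<subseteq> {j \<in> A. u j < u x}"
      by (auto simp: A dominators_def)
    then have "card (dominators E u m x) \<le> card {j \<in> A. u j < u x}"
      using fin by (intro card_mono) auto
    with card_lower_priority_less[OF fin x] show "P x" by (simp add: P_def)
  qed
  finally show ?thesis by (simp add: A_def)
qed

subsection \<open>Undominated items of a list\<close>

text \<open>Meant for lists of decreasing priority: the entries after \<open>x\<close> are then
  those of smaller priority, and the count becomes a statistic of the permutation alone.\<close>

fun undominated :: "nat \<Rightarrow> ('a \<Rightarrow> real) \<Rightarrow> 'a list \<Rightarrow> nat" where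
  "undominated k E [] = 0"
| "undominated k E (x # xs) =
     (if card {y \<in> set xs. E x \<le> E y} < k then 1 else 0) + undominated k E xs"

text \<open>The head has the largest priority, so removing it changes no other item's count.\<close>

lemma card_undominated:
  fixes u :: "'a \<Rightarrow> real"
  assumes "sorted_wrt (>) (map u w)"
  shows "card {i \<in> set w. card {j \<in> set w. E i \<le> E j \<and> u j < u i} < k} = undominated k E w"
  using assms
proof (induction w)
  case Nil
  then show ?case by simp
next
  case (Cons x xs)
  let ?good = "\<lambda>w i. card {j \<in> set w. E i \<le> E j \<and> u j < u i} < k"
  have less: "u y < u x" if "y \<in> set xs" for y
    using Cons.prems that by auto
  have "x \<notin> set xs" using less by blast
  have "{j \<in> set (x # xs). E x \<le> E j \<and> u j < u x} = {y \<in> set xs. E x \<le> E y}"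
    using less by auto
  moreover have "?good (x # xs) i = ?good xs i" if "i \<in> set xs" for i
  proof -
    have "{j \<in> set (x # xs). E i \<le> E j \<and> u j < u i} = {j \<in> set xs. E i \<le> E j \<and> u j < u i}"
      using less[OF that] by auto
    then show ?thesis by simp
  qed
  ultimately have "{i \<in> set (x # xs). ?good (x # xs) i}
      = (if card {y \<in> set xs. E x \<le> E y} < k then {x} else {}) \<union> {i \<in> set xs. ?good xs i}"
    by auto
  then show ?case using Cons \<open>x \<notin> set xs\<close> by (simp add: card_insert_if)
qed

text \<open>Only an inequality, as the right side also counts undominated items that have expired.
  The order is increasing, hence \<open>rev\<close>.\<close>

lemma card_sketch_le:
  assumes "expiration_stream n S E" "m \<le> n" "inj_on u {..<m}"
  shows "card (sketch k S E u m) \<le> undominated k E (rev (priority_order u {..<m}))"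
proof -
  let ?w = "rev (priority_order u {..<m})"
  have set: "set ?w = {..<m}" by (simp add: priority_order_props)
  have "distinct (map u (priority_order u {..<m}))"
    using assms(3) by (simp add: distinct_map priority_order_props)
  then have "sorted_wrt (<) (map u (priority_order u {..<m}))"
    by (simp add: strict_sorted_iff priority_order_props)
  then have "sorted_wrt (>) (map u ?w)"
    by (simp add: rev_map[symmetric] sorted_wrt_rev)
  note card_undominated[OF this, of E k]
  moreover have "sketch k S E u m \<subseteq> {i \<in> {..<m}. card {j \<in> {..<m}. E i \<le> E j \<and> u j < u i} < k}"
    by (auto simp: sketch_eq[OF assms(1,2)] dominators_def)
  ultimately show ?thesis
    unfolding set
    using card_mono[of "{i \<in> {..<m}. card {j \<in> {..<m}. E i \<le> E j \<and> u j < u i} < k}" "sketch k S E u m"]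
    by simp
qed

text \<open>Among the items counted take one of smallest \<open>E\<close>: all others counted expire
  no earlier, so there are fewer than \<open>k\<close> of them.\<close>

lemma card_few_above_le:
  fixes E :: "'a \<Rightarrow> real"
  assumes "finite A"
  shows "card {x \<in> A. card {y \<in> A - {x}. E x \<le> E y} < k} \<le> k"
proof (rule ccontr)
  let ?T = "{x \<in> A. card {y \<in> A - {x}. E x \<le> E y} < k}"
  assume *: "\<not> card ?T \<le> k"
  then have "?T \<noteq> {}" by (intro notI) (simp only: card.empty)
  have "finite ?T" using assms by auto
  with \<open>?T \<noteq> {}\<close>   obtain x where x: "x \<in> ?T" "\<forall>y\<in>?T. E x \<le> E y"
    by (metis (no_types, lifting) arg_min_if_finite(1) arg_min_least)
  then have "card (?T - {x}) \<le> card {y \<in> A - {x}. E x \<le> E y}"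
    using assms by (intro card_mono) auto
  also have "\<dots> < k" using x(1) by simp
  finally show False using * x(1) \<open>finite ?T\<close> by (simp add: card_Diff_singleton)
qed

text \<open>
  The head of the list is the item of largest priority. It dominates nothing, and it is
  undominated for at most \<open>k\<close> of the \<open>card A\<close> possible choices.
\<close>

lemma sum_exp_undominated_le:
  assumes "finite A"
  shows "(\<Sum>w\<in>permutations_of_set A. exp (real (undominated k E w)))
           \<le> fact (card A) * exp (2 * real k * harm (card A))"
  using assms
proof (induction "card A" arbitrary: A)
  case 0
  then show ?case by (simp add: harm_def)
next
  case (Suc N)
  let ?F = "\<lambda>A. \<Sum>w\<in>permutations_of_set A. exp (real (undominated k E w))"
  let ?b = "\<lambda>x. if card {y \<in> A - {x}. E x \<le> E y} < k then exp 1 else 1 :: real"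
  let ?G = "fact N * exp (2 * real k * harm N) :: real"
  have "A \<noteq> {}" using Suc by auto
  \<comment> \<open>Split by the head \<open>x\<close>: it contributes the factor
    \<open>?b x\<close>, and the tail runs over all permutations of \<open>A - {x}\<close>.\<close>
  then have "?F A = (\<Sum>w\<in>(\<Union>x\<in>A. (#) x ` permutations_of_set (A - {x})). exp (real (undominated k E w)))"
    by (simp add: permutations_of_set_nonempty)
  also have "\<dots> = (\<Sum>x\<in>A. \<Sum>w\<in>(#) x ` permutations_of_set (A - {x}). exp (real (undominated k E w)))"
    using Suc.prems by (intro sum.UNION_disjoint) auto
  also have "\<dots> = (\<Sum>x\<in>A. ?b x * ?F (A - {x}))"
  proof (intro sum.cong refl)
    fix x assume "x \<in> A"
    show "(\<Sum>w\<in>(#) x ` permutations_of_set (A - {x}). exp (real (undominated k E w))) = ?b x * ?F (A - {x})"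
      by (subst sum.reindex)
        (auto simp: inj_on_def sum_distrib_left exp_add permutations_of_set_def intro!: sum.cong)
  qed
  also have "\<dots> \<le> (\<Sum>x\<in>A. ?b x * ?G)"
  proof (intro sum_mono mult_left_mono)
    fix x assume "x \<in> A"
    then have "N = card (A - {x})" using Suc by simp
    then show "?F (A - {x}) \<le> ?G" using Suc by (metis finite_Diff)
  qed auto
  also have "\<dots> = (\<Sum>x\<in>A. ?b x) * ?G" by (simp add: sum_distrib_right)
  also have "(\<Sum>x\<in>A. ?b x) = real (Suc N) + (exp 1 - 1) * card {x \<in> A. card {y \<in> A - {x}. E x \<le> E y} < k}"
  proof -
    have "(\<Sum>x\<in>A. ?b x) = (\<Sum>x\<in>A. 1 + (if card {y \<in> A - {x}. E x \<le> E y} < k then exp 1 - 1 else 0))"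
      by (intro sum.cong) auto
    then show ?thesis
      using Suc by (simp add: sum.distrib sum.If_cases Int_def)
  qed
  also have "\<dots> \<le> real (Suc N) + 2 * real k"
  proof -
    \<comment> \<open>The bound \<open>e \<le> 3\<close> is the origin of the factor 2 in the
      exponent.\<close>
    have "exp 1 - 1 \<le> (2::real)" using exp_le by simp
    moreover have "real (card {x \<in> A. card {y \<in> A - {x}. E x \<le> E y} < k}) \<le> real k"
      using card_few_above_le[OF Suc.prems, of E k] by simp
    ultimately show ?thesis by (intro add_left_mono mult_mono) auto
  qed
  also have "\<dots> = real (Suc N) * (1 + 2 * real k / real (Suc N))"
    by (simp add: field_simps del: of_nat_Suc)
  \<comment> \<open>\<open>1 + x \<le> exp x\<close> turns the product of these factors into the
    exponential of a harmonic sum.\<close>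
  also have "\<dots> \<le> real (Suc N) * exp (2 * real k / real (Suc N))"
    by (intro mult_left_mono exp_ge_add_one_self) auto
  also have "real (Suc N) * exp (2 * real k / real (Suc N)) * ?G
      = fact (Suc N) * exp (2 * real k * harm (Suc N))"
  proof -
    have "2 * real k * harm (Suc N) = 2 * real k * harm N + 2 * real k / real (Suc N)"
      by (simp add: harm_Suc distrib_left divide_inverse del: of_nat_Suc)
    then show ?thesis by (simp add: exp_add del: of_nat_Suc)
  qed
  finally show ?case using Suc(2) by (simp add: mult_right_mono)
qed

subsection \<open>Random priority orders\<close>

text \<open>\<open>F\<close> factors through the relation of strict comparisons on
  \<open>{..<n}\<close>. This relation takes finitely many values, and each value is attained on a
  finite intersection of events \<open>u i < u j\<close> and their complements.\<close>

lemma measurable_of_comparisons: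
  fixes u :: "nat \<Rightarrow> 'w \<Rightarrow> real" and F :: "(nat \<Rightarrow> real) \<Rightarrow> 'b"
  assumes u [measurable]: "\<And>i. i < n \<Longrightarrow> u i \<in> borel_measurable M"
    and F: "\<And>v v'. (\<And>i j. i < n \<Longrightarrow> j < n \<Longrightarrow> v i < v j \<longleftrightarrow> v' i < v' j) \<Longrightarrow> F v = F v'"
  shows "(\<lambda>\<omega>. F (\<lambda>i. u i \<omega>)) \<in> measurable M (count_space UNIV)"
proof -
  define R where "R v = {(i, j). i < n \<and> j < n \<and> v i < v j}" for v :: "nat \<Rightarrow> real"
  \<comment> \<open>Any representative of \<open>r\<close> will do, as \<open>F\<close> is constant
    on the fibres of \<open>R\<close>.\<close>
  define G where "G r = F (SOME v. R v = r)" for r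
  have FG: "F v = G (R v)" for v
  proof -
    have "R (SOME v'. R v' = R v) = R v" by (rule someI[of _ v]) simp
    then have "F (SOME v'. R v' = R v) = F v"
      by (intro F) (auto simp: R_def set_eq_iff)
    then show ?thesis by (simp add: G_def)
  qed
  let ?K = "Pow ({..<n} \<times> {..<n})"
  have "(\<lambda>\<omega>. R (\<lambda>i. u i \<omega>)) \<in> measurable M (count_space ?K)"
  proof (subst measurable_count_space_eq2, simp, intro conjI ballI)
    show "(\<lambda>\<omega>. R (\<lambda>i. u i \<omega>)) \<in> space M \<rightarrow> ?K" by (auto simp: R_def)
    fix r assume "r \<in> ?K"
    then have "(\<lambda>\<omega>. R (\<lambda>i. u i \<omega>)) -` {r} \<inter> space M
        = {\<omega> \<in> space M. \<forall>i\<in>{..<n}. \<forall>j\<in>{..<n}. u i \<omega> < u j \<omega> \<longleftrightarrow> (i, j) \<in> r}"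
      by (auto simp: R_def)
    also have "\<dots> \<in> sets M"
      by (intro sets.sets_Collect_finite_All) auto
    finally show "(\<lambda>\<omega>. R (\<lambda>i. u i \<omega>)) -` {r} \<inter> space M \<in> sets M" .
  qed
  then show ?thesis
    unfolding FG by (rule measurable_compose) simp
qed

text \<open>Every \<open>k\<close>-subset \<open>B\<close> arises from the same number of
  permutations, \<open>k! (N - k)!\<close> with \<open>N = card A\<close>: an ordering of
  \<open>B\<close> followed by one of \<open>A - B\<close>.\<close>

lemma map_pmf_set_take_permutations:
  assumes "finite A" "k \<le> card A"
  shows "map_pmf (\<lambda>w. set (take k w)) (pmf_of_set (permutations_of_set A))
           = pmf_of_set {B. B \<subseteq> A \<and> card B = k}"
proof (rule pmf_eqI)
  fix B
  let ?P = "permutations_of_set A"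
  let ?fib = "?P \<inter> (\<lambda>w. set (take k w)) -` {B}"
  have P: "finite ?P" "?P \<noteq> {}" using assms by auto
  have S: "finite {B. B \<subseteq> A \<and> card B = k}" "card {B. B \<subseteq> A \<and> card B = k} = card A choose k"
    using assms n_subsets by auto
  then have "{B. B \<subseteq> A \<and> card B = k} \<noteq> {}"
    using assms by (metis card.empty binomial_eq_0_iff not_less)
  note S = S this
  have lhs: "pmf (map_pmf (\<lambda>w. set (take k w)) (pmf_of_set ?P)) B = card ?fib / fact (card A)"
    using P assms by (simp add: pmf_map measure_pmf_of_set)
  show "pmf (map_pmf (\<lambda>w. set (take k w)) (pmf_of_set ?P)) B = pmf (pmf_of_set {B. B \<subseteq> A \<and> card B = k}) B"
  proof (cases "B \<subseteq> A \<and> card B = k")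
    case True
    then have "finite B" using assms finite_subset by auto
    have "?fib = (\<lambda>(x, y). x @ y) ` (permutations_of_set B \<times> permutations_of_set (A - B))"
    proof (intro equalityI subsetI)
      fix w assume w: "w \<in> ?fib"
      then have "take k w \<in> permutations_of_set B"
        by (auto simp: permutations_of_set_def)
      moreover have "drop k w \<in> permutations_of_set (A - B)"
      proof -
        have w': "set w = A" "distinct w" "set (take k w) = B"
          using w by (auto simp: permutations_of_set_def)
        moreover have "set (take k w) \<union> set (drop k w) = A"
          by (metis append_take_drop_id set_append w'(1))
        moreover have "set (take k w) \<inter> set (drop k w) = {}"
          using w'(2) by (metis append_take_drop_id distinct_append)
        ultimately show ?thesis by (auto simp: permutations_of_set_def)
      qed
      ultimately show "w \<in> (\<lambda>(x, y). x @ y) ` (permutations_of_set B \<times> permutations_of_set (A - B))"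
        by (intro image_eqI[of _ _ "(take k w, drop k w)"]) auto
    next
      fix w assume "w \<in> (\<lambda>(x, y). x @ y) ` (permutations_of_set B \<times> permutations_of_set (A - B))"
      then obtain x y where w: "w = x @ y" "x \<in> permutations_of_set B" "y \<in> permutations_of_set (A - B)"
        by auto
      then have "length x = k" using True length_finite_permutations_of_set by blast
      then show "w \<in> ?fib" using w True by (auto simp: permutations_of_set_def)
    qed
    moreover have "inj_on (\<lambda>(x, y). x @ y) (permutations_of_set B \<times> permutations_of_set (A - B))"
    proof (rule inj_onI, clarify)
      fix x y x' y'
      assume *: "x \<in> permutations_of_set B" "x' \<in> permutations_of_set B" "x @ y = x' @ y'"
      then have "length x = length x'" by (metis length_finite_permutations_of_set)
      then show "x = x' \<and> y = y'" using *(3) by simp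
    qed
    ultimately have "card ?fib = fact k * fact (card A - k)"
      using True assms \<open>finite B\<close> by (simp add: card_image card_Diff_subset)
    then have "pmf (map_pmf (\<lambda>w. set (take k w)) (pmf_of_set ?P)) B = 1 / real (card A choose k)"
      unfolding lhs by (simp add: binomial_fact[OF assms(2)])
    also have "\<dots> = pmf (pmf_of_set {B. B \<subseteq> A \<and> card B = k}) B"
      by (subst pmf_of_set[OF S(3,1)]) (use True S(2) in simp)
    finally show ?thesis .
  next
    case False
    have "?fib = {}"
    proof (rule ccontr)
      assume "?fib \<noteq> {}"
      then obtain w where w: "set w = A" "distinct w" "set (take k w) = B"
        by (auto simp: permutations_of_set_def)
      then have "B \<subseteq> A" using set_take_subset[of k w] by simp
      moreover have "card B = k"
        using w assms(2) distinct_card[of "take k w"] distinct_card[of w] by simp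
      ultimately show False using False by simp
    qed
    then have "pmf (map_pmf (\<lambda>w. set (take k w)) (pmf_of_set ?P)) B = 0"
      unfolding lhs by simp
    also have "0 = pmf (pmf_of_set {B. B \<subseteq> A \<and> card B = k}) B"
      by (subst pmf_of_set[OF S(3,1)]) (use False in simp)
    finally show ?thesis .
  qed
qed

context prob_space
begin

text \<open>By independence a pair of priorities has a product law, for which the diagonal is null
  by Fubini, its sections being single points. There are finitely many pairs.\<close>

lemma AE_inj_on_of_indep:
  fixes u :: "'i \<Rightarrow> 'a \<Rightarrow> real"
  assumes indep: "indep_vars (\<lambda>_. borel) u I" and fin: "finite I"
    and nonatomic: "\<And>i x. i \<in> I \<Longrightarrow> emeasure (distr M borel (u i)) {x} = 0"
  shows "AE \<omega> in M. inj_on (\<lambda>i. u i \<omega>) I"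
proof -
  have rv [measurable]: "i \<in> I \<Longrightarrow> u i \<in> borel_measurable M" for i
    using indep by (auto simp: indep_vars_def)
  have "AE \<omega> in M. u i \<omega> \<noteq> u j \<omega>" if ij: "i \<in> I" "j \<in> I" "i \<noteq> j" for i j
  proof -
    have [measurable]: "u i \<in> borel_measurable M" "u j \<in> borel_measurable M"
      using ij by auto
    let ?N = "\<lambda>i. distr M borel (u i)"
    interpret Ni: prob_space "?N i" by (rule prob_space_distr) simp
    interpret Nj: prob_space "?N j" by (rule prob_space_distr) simp
    \<comment> \<open>Pairwise independence comes from the disjoint blocks \<open>{i}\<close> and
      \<open>{j}\<close>, each followed by evaluation at its only index.\<close>
    have "indep_var borel ((\<lambda>f. f i) \<circ> (\<lambda>\<omega>. restrict (\<lambda>i. u i \<omega>) {i}))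
             borel ((\<lambda>f. f j) \<circ> (\<lambda>\<omega>. restrict (\<lambda>i. u i \<omega>) {j}))"
      using ij by (intro indep_var_compose[OF indep_var_restrict[OF indep]]) auto
    then have "indep_var borel (u i) borel (u j)" by (simp add: comp_def)
    then have joint: "distr M (borel \<Otimes>\<^sub>M borel) (\<lambda>\<omega>. (u i \<omega>, u j \<omega>)) = ?N i \<Otimes>\<^sub>M ?N j"
      by (simp add: indep_var_distribution_eq)
    let ?D = "{z :: real \<times> real. fst z = snd z}"
    have "{z \<in> space (borel \<Otimes>\<^sub>M borel). fst z = snd z} \<in> sets (borel \<Otimes>\<^sub>M (borel :: real measure))"
      by measurable
    then have D: "?D \<in> sets (borel \<Otimes>\<^sub>M borel)" by (simp add: space_pair_measure)
    then have D': "?D \<in> sets (?N i \<Otimes>\<^sub>M ?N j)"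
      by (subst sets_pair_measure_cong[of _ borel _ borel]) auto
    have "emeasure (?N i \<Otimes>\<^sub>M ?N j) ?D = (\<integral>\<^sup>+ x. emeasure (?N j) (Pair x -` ?D) \<partial>?N i)"
      by (rule Nj.emeasure_pair_measure_alt[OF D'])
    also have "\<dots> = 0"
    proof -
      have "Pair x -` ?D = {x}" for x :: real by auto
      then show ?thesis using nonatomic[OF ij(2)] by simp
    qed
    finally have "emeasure (distr M (borel \<Otimes>\<^sub>M borel) (\<lambda>\<omega>. (u i \<omega>, u j \<omega>))) ?D = 0"
      by (simp add: joint)
    then have "emeasure M {\<omega> \<in> space M. u i \<omega> = u j \<omega>} = 0"
      using D by (subst (asm) emeasure_distr) (auto simp: vimage_def Int_def conj_commute)
    then show ?thesis
      by (subst AE_iff_measurable[OF _ refl]) auto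
  qed
  then have "AE \<omega> in M. \<forall>i\<in>I. \<forall>j\<in>I. i \<noteq> j \<longrightarrow> u i \<omega> \<noteq> u j \<omega>"
    using fin by (auto simp: AE_finite_all)
  then show ?thesis by eventually_elim (auto simp: inj_on_def)
qed

text \<open>Exchangeability: the right side mentions \<open>w\<close> only through its length, so
  lists of equal length are sorted by priority with equal probability.\<close>

lemma prob_sorted_along_eq:
  fixes u :: "'i \<Rightarrow> 'a \<Rightarrow> real"
  assumes indep: "indep_vars (\<lambda>_. borel) u I"
    and ident: "\<And>i. i \<in> I \<Longrightarrow> distr M borel (u i) = N"
    and w: "distinct w" "set w \<subseteq> I"
  shows "prob {\<omega> \<in> space M. sorted_wrt (<) (map (\<lambda>i. u i \<omega>) w)}
    = measure (PiM {..<length w} (\<lambda>_. N)) {y \<in> space (PiM {..<length w} (\<lambda>_. N)).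
        \<forall>q\<in>{..<length w}. \<forall>p\<in>{..<q}. y p < y q}"
proof (cases "w = []")
  \<comment> \<open>Here \<open>I\<close> may be empty and \<open>N\<close> unconstrained; both
    sides are 1.\<close>
  case True
  interpret P: prob_space "PiM {} (\<lambda>_. N)" by (rule prob_space_PiM) auto
  show ?thesis using True prob_space P.prob_space by simp
next
  case False
  let ?A = "set w" and ?J = "{..<length w}"
  have rv [measurable]: "i \<in> ?A \<Longrightarrow> u i \<in> borel_measurable M" for i
    using indep w by (auto simp: indep_vars_def)
  obtain i where i: "i \<in> I" using False w by (cases w) auto
  have setsN [measurable_cong]: "sets N = sets borel" unfolding ident[OF i, symmetric] by simp
  have "prob_space N"
    unfolding ident[OF i, symmetric] using indep i
    by (intro prob_space_distr) (simp add: indep_vars_def)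
  then interpret N: prob_space N .
  have "indep_vars (\<lambda>_. borel) u ?A" using indep w(2) by (rule indep_vars_subset)
  then have "distr M (PiM ?A (\<lambda>_. borel)) (\<lambda>\<omega>. \<lambda>i\<in>?A. u i \<omega>) = PiM ?A (\<lambda>i. distr M borel (u i))"
    using False rv by (subst (asm) indep_vars_iff_distr_eq_PiM') auto
  also have "\<dots> = PiM ?A (\<lambda>_. N)"
    using w ident by (intro PiM_cong) auto
  finally have joint: "distr M (PiM ?A (\<lambda>_. borel)) (\<lambda>\<omega>. \<lambda>i\<in>?A. u i \<omega>) = PiM ?A (\<lambda>_. N)" .
  \<comment> \<open>Relabelling the index \<open>w ! p\<close> as position \<open>p\<close>
    preserves an i.i.d. product law.\<close>
  have "distr (PiM ?A (\<lambda>_. N)) (PiM ?J (\<lambda>_. N)) (\<lambda>y. \<lambda>p\<in>?J. y (w ! p)) = PiM ?J (\<lambda>_. N)"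
    using w by (intro distr_PiM_reindex) (auto simp: inj_on_nth N.prob_space_axioms)
  then have "PiM ?J (\<lambda>_. N) = distr (distr M (PiM ?A (\<lambda>_. borel)) (\<lambda>\<omega>. \<lambda>i\<in>?A. u i \<omega>))
      (PiM ?J (\<lambda>_. N)) (\<lambda>y. \<lambda>p\<in>?J. y (w ! p))"
    unfolding joint by simp
  also have "\<dots> = distr M (PiM ?J (\<lambda>_. N)) ((\<lambda>y. \<lambda>p\<in>?J. y (w ! p)) \<circ> (\<lambda>\<omega>. \<lambda>i\<in>?A. u i \<omega>))"
    by (rule distr_distr) (auto intro!: measurable_restrict)
  also have "\<dots> = distr M (PiM ?J (\<lambda>_. N)) (\<lambda>\<omega>. \<lambda>p\<in>?J. u (w ! p) \<omega>)"
    by (intro distr_cong) (auto simp: fun_eq_iff restrict_def)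
  finally have eq: "PiM ?J (\<lambda>_. N) = distr M (PiM ?J (\<lambda>_. N)) (\<lambda>\<omega>. \<lambda>p\<in>?J. u (w ! p) \<omega>)" .
  let ?Y = "{y \<in> space (PiM ?J (\<lambda>_. N)). \<forall>q\<in>?J. \<forall>p\<in>{..<q}. y p < y q}"
  have Y: "?Y \<in> sets (PiM ?J (\<lambda>_. N))"
  proof (intro sets.sets_Collect_finite_All)
    fix p q assume "q \<in> ?J" "p \<in> {..<q}"
    then have [measurable]: "p \<in> ?J" "q \<in> ?J" by auto
    have [measurable]: "(\<lambda>y. y p) \<in> borel_measurable (PiM ?J (\<lambda>_. N))" "(\<lambda>y. y q) \<in> borel_measurable (PiM ?J (\<lambda>_. N))"
      using measurable_component_singleton[of p ?J "\<lambda>_. N"] measurable_component_singleton[of q ?J "\<lambda>_. N"]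
      by (simp_all add: measurable_cong_sets[OF refl setsN])
    show "{y \<in> space (PiM ?J (\<lambda>_. N)). y p < y q} \<in> sets (PiM ?J (\<lambda>_. N))" by measurable
  qed auto
  have Z: "(\<lambda>\<omega>. \<lambda>p\<in>?J. u (w ! p) \<omega>) \<in> measurable M (PiM ?J (\<lambda>_. N))"
    by (rule measurable_restrict) (auto simp: measurable_cong_sets[OF refl setsN])
  have "measure (PiM ?J (\<lambda>_. N)) ?Y = prob ((\<lambda>\<omega>. \<lambda>p\<in>?J. u (w ! p) \<omega>) -` ?Y \<inter> space M)"
    by (subst eq, rule measure_distr[OF Z Y])
  also have "(\<lambda>\<omega>. \<lambda>p\<in>?J. u (w ! p) \<omega>) -` ?Y \<inter> space M
      = {\<omega> \<in> space M. sorted_wrt (<) (map (\<lambda>i. u i \<omega>) w)}"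
    using measurable_space[OF Z] by (auto simp: sorted_wrt_iff_nth_less)
  finally show ?thesis by simp
qed

text \<open>Up to ties, which are null, the order is \<open>w\<close> iff priorities increase along
  \<open>w\<close>. By exchangeability all permutations share one probability \<open>c\<close>, and
  the total being 1 fixes it.\<close>

lemma distr_priority_order:
  fixes u :: "nat \<Rightarrow> 'a \<Rightarrow> real"
  assumes indep: "indep_vars (\<lambda>_. borel) u {..<n}"
    and ident: "\<And>i. i < n \<Longrightarrow> distr M borel (u i) = N"
    and nonatomic: "\<And>x. emeasure N {x} = 0"
    and A: "A \<subseteq> {..<n}"
  shows "(\<lambda>\<omega>. priority_order (\<lambda>i. u i \<omega>) A) \<in> measurable M (count_space UNIV)" (is "?X \<in> _")
    and "distr M (count_space UNIV) (\<lambda>\<omega>. priority_order (\<lambda>i. u i \<omega>) A)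
           = measure_pmf (pmf_of_set (permutations_of_set A))"
proof -
  have finA: "finite A" using A finite_subset by auto
  have rv: "u i \<in> borel_measurable M" if "i < n" for i
    using indep that by (auto simp: indep_vars_def)
  show X [measurable]: "?X \<in> measurable M (count_space UNIV)"
    using A by (intro measurable_of_comparisons[of n] rv priority_order_cong[OF finA]) auto
  let ?P = "permutations_of_set A"
  \<comment> \<open>A reference permutation: constant priorities give the index order.\<close>
  let ?w0 = "priority_order (\<lambda>_. 0) A"
  define c where "c = prob {\<omega> \<in> space M. sorted_wrt (<) (map (\<lambda>i. u i \<omega>) ?w0)}"
  have inj: "AE \<omega> in M. inj_on (\<lambda>i. u i \<omega>) {..<n}"
    using ident nonatomic by (intro AE_inj_on_of_indep indep) auto
  have c: "prob {\<omega> \<in> space M. ?X \<omega> = w} = c" if w: "w \<in> ?P" for w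
  proof -
    have "prob {\<omega> \<in> space M. ?X \<omega> = w} = prob {\<omega> \<in> space M. sorted_wrt (<) (map (\<lambda>i. u i \<omega>) w)}"
    proof (rule finite_measure_eq_AE)
      show "AE \<omega> in M. \<omega> \<in> {\<omega> \<in> space M. ?X \<omega> = w}
          \<longleftrightarrow> \<omega> \<in> {\<omega> \<in> space M. sorted_wrt (<) (map (\<lambda>i. u i \<omega>) w)}"
        using inj
      proof eventually_elim
        case (elim \<omega>)
        then have "inj_on (\<lambda>i. u i \<omega>) A" using A inj_on_subset by blast
        then have "sorted_wrt (<) (map (\<lambda>i. u i \<omega>) (?X \<omega>))"
          using finA by (simp add: strict_sorted_iff distinct_map priority_order_props)
        then show ?case using priority_order_unique[OF finA w] by auto
      qed
      show "{\<omega> \<in> space M. ?X \<omega> = w} \<in> events" by measurable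
      have "(\<lambda>\<omega>. sorted_wrt (<) (map (\<lambda>i. u i \<omega>) w)) \<in> measurable M (count_space UNIV)"
      proof (rule measurable_of_comparisons[of n, OF rv])
        fix v v' :: "nat \<Rightarrow> real"
        assume "\<And>i j. i < n \<Longrightarrow> j < n \<Longrightarrow> v i < v j \<longleftrightarrow> v' i < v' j"
        moreover have "set w \<subseteq> {..<n}" using w A by (auto simp: permutations_of_set_def)
        ultimately show "sorted_wrt (<) (map v w) = sorted_wrt (<) (map v' w)"
          by (auto simp: sorted_wrt_map intro: sorted_wrt_mono_rel[rotated])
      qed
      then show "{\<omega> \<in> space M. sorted_wrt (<) (map (\<lambda>i. u i \<omega>) w)} \<in> events"
        by (simp add: pred_def)
    qed
    also have "\<dots> = c"
    proof -
      have "distinct w" "set w \<subseteq> {..<n}" "length w = card A" "distinct ?w0" "set ?w0 \<subseteq> {..<n}" "length ?w0 = card A"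
        using w A finA by (auto simp: permutations_of_set_def priority_order_props distinct_card)
      then show ?thesis
        unfolding c_def using prob_sorted_along_eq[OF indep, of N] ident by simp
    qed
    finally show ?thesis .
  qed
  have "1 = prob (\<Union>w\<in>?P. {\<omega> \<in> space M. ?X \<omega> = w})"
  proof -
    have "(\<Union>w\<in>?P. {\<omega> \<in> space M. ?X \<omega> = w}) = space M"
      using priority_order_in_permutations[OF finA] by auto
    then show ?thesis by (simp add: prob_space)
  qed
  also have "\<dots> = (\<Sum>w\<in>?P. prob {\<omega> \<in> space M. ?X \<omega> = w})"
    by (rule finite_measure_finite_Union) (auto simp: disjoint_family_on_def)
  also have "\<dots> = real (card ?P) * c" using c by simp
  finally have c_eq: "c = 1 / card ?P" using finA by (auto simp: field_simps)
  show "distr M (count_space UNIV) ?X = measure_pmf (pmf_of_set ?P)"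
  proof (rule measure_eqI_countable[of _ UNIV])
    fix w
    have fin: "finite ?P" "?P \<noteq> {}" using finA by auto
    have "emeasure (distr M (count_space UNIV) ?X) {w} = ennreal (prob {\<omega> \<in> space M. ?X \<omega> = w})"
      by (simp add: emeasure_distr emeasure_eq_measure vimage_def Int_def conj_commute)
    also have "prob {\<omega> \<in> space M. ?X \<omega> = w} = pmf (pmf_of_set ?P) w"
    proof (cases "w \<in> ?P")
      case True
      then show ?thesis using c[OF True] c_eq fin by simp
    next
      case False
      then have "{\<omega> \<in> space M. ?X \<omega> = w} = {}"
        using priority_order_in_permutations[OF finA] by auto
      then show ?thesis using False fin by (simp del: Collect_empty_eq)
    qed
    finally show "emeasure (distr M (count_space UNIV) ?X) {w} = emeasure (measure_pmf (pmf_of_set ?P)) {w}"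
      by (simp add: emeasure_pmf_single)
  qed auto
qed

end

subsection \<open>The memory bound\<close>

lemma emeasure_uniform_singleton:
  "emeasure (uniform_measure lborel {0<..1::real}) {x} = 0"
proof -
  have "emeasure lborel ({0<..1} \<inter> {x}) \<le> emeasure lborel {x}"
    by (rule emeasure_mono) auto
  then show ?thesis by (simp add: emeasure_uniform_measure)
qed

text \<open>Markov's inequality for the exponential, in counting form. Reversal maps the
  permutations of \<open>A\<close> onto themselves, so it leaves the sum unchanged.\<close>

lemma card_many_undominated_le:
  assumes "finite A"
  shows "real (card {w \<in> permutations_of_set A. a < real (undominated k E (rev w))})
           \<le> fact (card A) * exp (2 * real k * harm (card A) - a)"
proof -
  let ?P = "permutations_of_set A" and ?f = "\<lambda>w. exp (real (undominated k E w))"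
  let ?B = "{w \<in> ?P. a < real (undominated k E (rev w))}"
  have "real (card ?B) * exp a = (\<Sum>w\<in>?B. exp a)" by simp
  also have "\<dots> \<le> (\<Sum>w\<in>?B. ?f (rev w))"
    by (intro sum_mono) auto
  also have "\<dots> \<le> (\<Sum>w\<in>?P. ?f (rev w))"
    by (intro sum_mono2) auto
  also have "\<dots> = (\<Sum>w\<in>rev ` ?P. ?f w)"
    by (subst sum.reindex) (auto simp: inj_on_def)
  also have "\<dots> = (\<Sum>w\<in>?P. ?f w)" by simp
  also have "\<dots> \<le> fact (card A) * exp (2 * real k * harm (card A))"
    by (rule sum_exp_undominated_le[OF assms])
  finally show ?thesis by (simp add: exp_diff field_simps)
qed

text \<open>\<open>harm m - ln m\<close> is non-increasing and equals 1 at
  \<open>m = 1\<close>.\<close>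

lemma harm_le_one_plus_ln:
  assumes "1 \<le> m"
  shows "harm m \<le> 1 + ln (real m)"
  using euler_mascheroni_sequence_decreasing[of 1 m] assms by (simp add: harm_def)

lemma sketch_cong:
  assumes "expiration_stream n S E" "m \<le> n"
    and "\<And>i j. i < n \<Longrightarrow> j < n \<Longrightarrow> v i < v j \<longleftrightarrow> v' i < v' j"
  shows "sketch k S E v m = sketch k S E v' m"
proof -
  have "dominators E v m i = dominators E v' m i" if "i < m" for i
    using that assms(2,3) by (auto simp: dominators_def)
  then show ?thesis by (auto simp: sketch_eq[OF assms(1,2)])
qed

text \<open>The states range over uncountably many times \<open>t0\<close>, so measurability of the
  memory bound is drawn from dependence on comparisons alone.\<close>

lemma memory_states_cong:
  assumes "expiration_stream n S E"
    and "\<And>i j. i < n \<Longrightarrow> j < n \<Longrightarrow> v i < v j \<longleftrightarrow> v' i < v' j"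
  shows "memory_states k n S E v = memory_states k n S E v'"
proof -
  have *: "sketch k S E v m = sketch k S E v' m" if "m \<le> n" for m
    using sketch_cong assms that by blast
  have "stored k S E v m t0 = stored k S E v' m t0" if "stream_point n S m t0" for m t0
    using * that by (simp add: stored_def stream_point_def)
  with * show ?thesis
    unfolding memory_states_def
    by (intro arg_cong2[where f = "(\<union>)"] Collect_cong ex_cong1 rev_conj_cong refl) simp_all
qed

lemma finite_sketch: "finite (sketch k S E u m)"
  by (induction m) (auto simp: thin_def expire_def)

text \<open>Every state lies in some sketch enlarged by one incoming item, hence the extra 1. For
  \<open>m = 0\<close> the sketch is empty and \<open>1 \<le> L\<close> suffices.\<close>

lemma card_memory_state_le:
  assumes "1 \<le> L" "\<And>m. 1 \<le> m \<Longrightarrow> m \<le> n \<Longrightarrow> real (card (sketch k S E u m)) + 1 \<le> L"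
    and "P \<in> memory_states k n S E u"
  shows "real (card P) \<le> L"
proof -
  have bound: "real (card (sketch k S E u m)) + 1 \<le> L" if "m \<le> n" for m
    using assms(1,2) that by (cases "m = 0") auto
  have "\<exists>m\<le>n. P \<subseteq> insert m (sketch k S E u m)"
    using assms(3) unfolding memory_states_def
    by (elim UnE CollectE exE conjE; rule_tac x = m in exI)
      (auto simp: stored_def expire_def stream_point_def)
  then obtain m where m: "m \<le> n" "P \<subseteq> insert m (sketch k S E u m)" by blast
  have "card P \<le> card (insert m (sketch k S E u m))"
    using m finite_sketch by (intro card_mono) auto
  also have "\<dots> \<le> card (sketch k S E u m) + 1"
    by (simp add: card_insert_if finite_sketch)
  finally show ?thesis using bound[OF m(1)] by linarith
qed

text \<open>Used with \<open>K = k\<close>, \<open>h = harm m\<close>, \<open>l = ln n\<close>,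
  \<open>d = ln (1 / \<delta>)\<close>. The left side is at most
  \<open>- 7 * K * l - 6 * K - K * d + 1\<close>. The \<open>- l\<close> pays for the union bound
  over \<open>n\<close> insertions, and \<open>- d\<close> leaves \<open>\<delta>\<close>.\<close>

lemma tail_exponent_le:
  fixes h l d K :: real
  assumes "1 \<le> K" "0 \<le> l" "0 \<le> d" "h \<le> 1 + l"
  shows "2 * K * h - (K * (9 * l + 8 + d) - 1) \<le> - l - d"
proof -
  have "K * h \<le> K * (1 + l)" using assms by (intro mult_left_mono) auto
  moreover have "1 * l \<le> K * l" "1 * d \<le> K * d"
    using assms by (intro mult_right_mono; simp)+
  ultimately   show ?thesis using assms by (simp add: algebra_simps)
qed

theorem theorem6p2:
  fixes M :: "'w measure" and u :: "nat \<Rightarrow> 'w \<Rightarrow> real"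
    and S E :: "nat \<Rightarrow> real" and n k :: nat and \<delta> :: real
  assumes "1 \<le> n" and "1 \<le> k" and "0 < \<delta>" and "\<delta> < 1"
    and "expiration_stream n S E"
    and "prob_space M"
    and "prob_space.indep_vars M (\<lambda>_. borel) u {..<n}"
    and "\<And>i. i < n \<Longrightarrow> distr M borel (u i) = uniform_measure lborel {0<..1}"
  shows
    "(\<forall>m t0 t. stream_point n S m t0 \<and> t0 \<le> t \<longrightarrow>
        (let A = active_set S E m t;
             report = (\<lambda>\<omega>. query k E (\<lambda>i. u i \<omega>) (stored k S E (\<lambda>i. u i \<omega>) m t0) t)
         in (\<not> tail_zone k S E m t \<longrightarrow>
               report \<in> measurable M (count_space UNIV) \<and>
               distr M (count_space UNIV) report
                 = measure_pmf (pmf_of_set {B. B \<subseteq> A \<and> card B = k}))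
          \<and> (tail_zone k S E m t \<longrightarrow> (\<forall>\<omega>\<in>space M. report \<omega> = A))))
     \<and> measure M {\<omega> \<in> space M. \<forall>P \<in> memory_states k n S E (\<lambda>i. u i \<omega>).
           real (card P) \<le> real k * (9 * ln (real n) + 8 + ln (1 / \<delta>))} \<ge> 1 - \<delta>"
proof -
  interpret prob_space M by fact
  note order_distr = distr_priority_order[OF assms(7) assms(8) emeasure_uniform_singleton]
  have rv: "u i \<in> borel_measurable M" if "i < n" for i
    using assms(7) that by (auto simp: indep_vars_def)
  have sample: "(\<not> tail_zone k S E m t \<longrightarrow>
         (\<lambda>\<omega>. query k E (\<lambda>i. u i \<omega>) (stored k S E (\<lambda>i. u i \<omega>) m t0) t) \<in> measurable M (count_space UNIV) \<and>
         distr M (count_space UNIV) (\<lambda>\<omega>. query k E (\<lambda>i. u i \<omega>) (stored k S E (\<lambda>i. u i \<omega>) m t0) t)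
           = measure_pmf (pmf_of_set {B. B \<subseteq> active_set S E m t \<and> card B = k}))
      \<and> (tail_zone k S E m t \<longrightarrow>
         (\<forall>\<omega>\<in>space M. query k E (\<lambda>i. u i \<omega>) (stored k S E (\<lambda>i. u i \<omega>) m t0) t = active_set S E m t))"
    if point: "stream_point n S m t0" "t0 \<le> t" for m t0 t
  proof -
    let ?A = "active_set S E m t"
    have A: "?A \<subseteq> {..<n}" and fin: "finite ?A"
      using point by (auto simp: active_set_def stream_point_def)
    note query = query_stored_eq[OF assms(5) point, where k = k]
    \<comment> \<open>The report is the set of the first \<open>k\<close> entries of the random
      order, so its law is an image of the uniform law on permutations.\<close>
    have "distr M (count_space UNIV) ((\<lambda>w. set (take k w)) \<circ> (\<lambda>\<omega>. priority_order (\<lambda>i. u i \<omega>) ?A))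
        = distr (measure_pmf (pmf_of_set (permutations_of_set ?A))) (count_space UNIV) (\<lambda>w. set (take k w))"
      using order_distr[OF _ A] by (subst distr_distr[symmetric]) auto
    then have "distr M (count_space UNIV) (\<lambda>\<omega>. set (take k (priority_order (\<lambda>i. u i \<omega>) ?A)))
        = measure_pmf (pmf_of_set {B. B \<subseteq> ?A \<and> card B = k})" if "k \<le> card ?A"
      using map_pmf_set_take_permutations[OF fin that] by (simp add: comp_def map_pmf_rep_eq[symmetric])
    moreover have "(\<lambda>\<omega>. set (take k (priority_order (\<lambda>i. u i \<omega>) ?A))) \<in> measurable M (count_space UNIV)"
      using order_distr(1)[OF _ A] by (rule measurable_compose) auto
    \<comment> \<open>In the tail zone \<open>take k\<close> returns the whole list, for every
      outcome.\<close>
    moreover have "set (take k (priority_order v ?A)) = ?A" if "card ?A \<le> k" for v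
      using that fin by (simp add: priority_order_props)
    ultimately show ?thesis by (simp add: query tail_zone_def)
  qed
  define L where "L = real k * (9 * ln (real n) + 8 + ln (1 / \<delta>))"
  have nonneg: "0 \<le> ln (real n)" "0 \<le> ln (1 / \<delta>)" using assms(1,3,4) by auto
  have "1 * 1 \<le> L"
    unfolding L_def using nonneg assms(2) by (intro mult_mono) auto
  then have "1 \<le> L" by simp
  \<comment> \<open>These events for \<open>1 \<le> m \<le> n\<close> cover every failure of the
    memory bound; the \<open>+ 1\<close> is the item being inserted.\<close>
  let ?bad = "\<lambda>m. {\<omega> \<in> space M. L < real (card (sketch k S E (\<lambda>i. u i \<omega>) m)) + 1}"
  let ?good = "{\<omega> \<in> space M. \<forall>P \<in> memory_states k n S E (\<lambda>i. u i \<omega>). real (card P) \<le> L}"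
  have inj: "AE \<omega> in M. inj_on (\<lambda>i. u i \<omega>) {..<n}"
    using assms(8) emeasure_uniform_singleton by (intro AE_inj_on_of_indep assms(7)) auto
  have bad_meas: "?bad m \<in> events" if "m \<le> n" for m
  proof -
    have "(\<lambda>\<omega>. L < real (card (sketch k S E (\<lambda>i. u i \<omega>) m)) + 1) \<in> measurable M (count_space UNIV)"
    proof (rule measurable_of_comparisons[of n, OF rv])
      fix v v' :: "nat \<Rightarrow> real"
      assume cmp: "\<And>i j. i < n \<Longrightarrow> j < n \<Longrightarrow> v i < v j \<longleftrightarrow> v' i < v' j"
      from sketch_cong[OF assms(5) that cmp, where k = k]
      show "(L < real (card (sketch k S E v m)) + 1) = (L < real (card (sketch k S E v' m)) + 1)"
        by simp
    qed
    then show ?thesis by (simp add: pred_def)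
  qed
  have good_meas: "?good \<in> events"
  proof -
    have "(\<lambda>\<omega>. \<forall>P \<in> memory_states k n S E (\<lambda>i. u i \<omega>). real (card P) \<le> L) \<in> measurable M (count_space UNIV)"
    proof (rule measurable_of_comparisons[of n, OF rv])
      fix v v' :: "nat \<Rightarrow> real"
      assume cmp: "\<And>i j. i < n \<Longrightarrow> j < n \<Longrightarrow> v i < v j \<longleftrightarrow> v' i < v' j"
      from memory_states_cong[OF assms(5) cmp, where k = k]
      show "(\<forall>P \<in> memory_states k n S E v. real (card P) \<le> L) = (\<forall>P \<in> memory_states k n S E v'. real (card P) \<le> L)"
        by simp
    qed
    then show ?thesis by (simp add: pred_def)
  qed
  have bad: "prob (?bad m) \<le> \<delta> / n" if m: "m \<in> {1..n}" for m
  proof -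
    let ?A = "{..<m}"
    let ?X = "\<lambda>\<omega>. priority_order (\<lambda>i. u i \<omega>) ?A"
    let ?W = "{w. L - 1 < real (undominated k E (rev w))}"
    have A: "?A \<subseteq> {..<n}" using m by auto
    have X [measurable]: "?X \<in> measurable M (count_space UNIV)"
      using order_distr(1)[OF _ A] by simp
    \<comment> \<open>The inclusion holds only almost surely: bounding the sketch by
      \<open>undominated\<close> requires distinct priorities.\<close>
    have "prob (?bad m) \<le> prob (?X -` ?W \<inter> space M)"
    proof (rule finite_measure_mono_AE)
      show "AE \<omega> in M. \<omega> \<in> ?bad m \<longrightarrow> \<omega> \<in> ?X -` ?W \<inter> space M"
        using inj
      proof eventually_elim
        case (elim \<omega>)
        then have "inj_on (\<lambda>i. u i \<omega>) ?A" using A inj_on_subset by blast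
        then have "card (sketch k S E (\<lambda>i. u i \<omega>) m) \<le> undominated k E (rev (?X \<omega>))"
          using m by (intro card_sketch_le[OF assms(5)]) auto
        then show ?case by auto
      qed
      show "?X -` ?W \<inter> space M \<in> events" by measurable
    qed
    also have "\<dots> = measure (distr M (count_space UNIV) ?X) ?W"
      by (simp add: measure_distr)
    also have "\<dots> = measure (measure_pmf (pmf_of_set (permutations_of_set ?A))) ?W"
      using order_distr(2)[OF _ A] by simp
    also have "\<dots> = real (card {w \<in> permutations_of_set ?A. L - 1 < real (undominated k E (rev w))}) / fact m"
      by (subst measure_pmf_of_set) (auto simp: Int_def)
    also have "\<dots> \<le> exp (2 * real k * harm m - (L - 1))"
      using card_many_undominated_le[of ?A "L - 1" k E] by (simp add: field_simps)
    also have "\<dots> \<le> exp (- ln (real n) - ln (1 / \<delta>))"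
    proof -
      \<comment> \<open>Passing from \<open>m\<close> to \<open>n\<close> makes the estimate uniform
        in \<open>m\<close>.\<close>
      have "harm m \<le> 1 + ln (real m)" using m by (intro harm_le_one_plus_ln) auto
      also have "\<dots> \<le> 1 + ln (real n)" using m by auto
      finally show ?thesis
        unfolding L_def using nonneg assms(2) by (intro exp_le_cancel_iff[THEN iffD2] tail_exponent_le) auto
    qed
    also have "\<dots> = \<delta> / n"
      using assms(1,3) by (simp add: exp_diff exp_minus ln_div field_simps)
    finally show ?thesis .
  qed
  \<comment> \<open>The union starts at 1, as the empty sketch is covered by
    \<open>1 \<le> L\<close>. This leaves \<open>n\<close> events of probability at most
    \<open>\<delta> / n\<close>.\<close>
  have "space M - ?good \<subseteq> (\<Union>m\<in>{1..n}. ?bad m)"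
  proof
    fix \<omega> assume \<omega>: "\<omega> \<in> space M - ?good"
    show "\<omega> \<in> (\<Union>m\<in>{1..n}. ?bad m)"
    proof (rule ccontr)
      assume "\<omega> \<notin> (\<Union>m\<in>{1..n}. ?bad m)"
      then have "real (card (sketch k S E (\<lambda>i. u i \<omega>) m)) + 1 \<le> L" if "1 \<le> m" "m \<le> n" for m
        using \<omega> that by fastforce
      from card_memory_state_le[OF \<open>1 \<le> L\<close> this] show False using \<omega> by blast
    qed
  qed
  then have "prob (space M - ?good) \<le> prob (\<Union>m\<in>{1..n}. ?bad m)"
    using bad_meas by (intro finite_measure_mono) auto
  also have "\<dots> \<le> (\<Sum>m\<in>{1..n}. prob (?bad m))"
    using bad_meas by (intro finite_measure_subadditive_finite) auto
  also have "\<dots> \<le> (\<Sum>m\<in>{1..n}. \<delta> / n)" by (intro sum_mono bad)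
  also have "\<dots> = \<delta>" using assms(1) by simp
  finally have "prob ?good \<ge> 1 - \<delta>" using good_meas by (simp add: prob_compl)
  then show ?thesis
    using sample unfolding L_def Let_def by blast
qed

end
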